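(* Let $(g_i):\ 0\to \mathfrak n_i\xrightarrow{\chi_i}\mathfrak g_i\xrightarrow{\pi_i}\mathfrak q_i\to 0$, $i=1,2$, be $\mathsf{Lie}$-central extensions of Leibniz algebras, and let $\eta:\mathfrak q_1\to\mathfrak q_2$ be an isomorphism. The following statements are equivalent: (a) $\eta$ induces a $\mathsf{Lie}$-isoclinism from $(g_1)$ to $(g_2)$, i.e. there is an isomorphism $\xi$ such that $(\eta,\xi)$ is a $\mathsf{Lie}$-isoclinism from $(g_1)$ to $(g_2)$. (b) There exists an isomorphism $\beta':[\mathfrak g_1,\mathfrak g_1]_{\mathsf{Lie}}\to[\mathfrak g_2,\mathfrak g_2]_{\mathsf{Lie}}$ with $\beta'\circ\theta'(g_1)=\theta'(g_2)\circ \mathrm{HL}_2^{\mathsf{Lie}}(\eta)$. (c) $\mathrm{HL}_2^{\mathsf{Lie}}(\eta)\big(\ker\theta(g_1)\big)=\ker\theta(g_2)$.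
   Context: $\mathbb K$ is a field with $\frac12\in\mathbb K$. A Leibniz algebra is a $\mathbb K$-vector space $\mathfrak q$ with a bilinear bracket satisfying $[x,[y,z]]=[[x,y],z]-[[x,z],y]$; homomorphisms are linear maps preserving the bracket. For two-sided ideals $\mathfrak m,\mathfrak n$ of $\mathfrak q$, $[\mathfrak m,\mathfrak n]_{\mathsf{Lie}}$ is the two-sided ideal of $\mathfrak q$ generated by $\{[m,n]+[n,m] : m\in\mathfrak m,n\in\mathfrak n\}$, and $Z_{\mathsf{Lie}}(\mathfrak q)=\{z\in\mathfrak q : [q,z]+[z,q]=0\ \forall q\in\mathfrak q\}$ (a two-sided ideal). An extension (short exact sequence of Leibniz algebras) $(g):0\to\mathfrak n\xrightarrow{\chi}\mathfrak g\xrightarrow{\pi}\mathfrak q\to0$ is $\mathsf{Lie}$-central if $\chi(\mathfrak n)\subseteq Z_{\mathsf{Lie}}(\mathfrak g)$, equivalently $[\chi(\mathfrak n),\mathfrak g]_{\mathsf{Lie}}=0$. Its $\mathsf{Lie}$-commutator map is the well-defined map $C:\mathfrak q\times\mathfrak q\to[\mathfrak g,\mathfrak g]_{\mathsf{Lie}}$, $C(q_1,q_2)=[x_1,x_2]+[x_2,x_1]$ where $\pi(x_j)=q_j$. A $\mathsf{Lie}$-isoclinism from $(g_1)$ to $(g_2)$ (with commutator maps $C_1,C_2$) is a pair $(\eta,\xi)$ of isomorphisms $\eta:\mathfrak q_1\to\mathfrak q_2$, $\xi:[\mathfrak g_1,\mathfrak g_1]_{\mathsf{Lie}}\to[\mathfrak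 g_2,\mathfrak g_2]_{\mathsf{Lie}}$ with $\xi\circ C_1=C_2\circ(\eta\times\eta)$. $\mathsf{Lie}$-homology: for a free presentation $0\to\mathfrak r\to\mathfrak f\xrightarrow{\rho}\mathfrak q\to0$ of $\mathfrak q$ ($\mathfrak f$ a free Leibniz algebra), $\mathrm{HL}_2^{\mathsf{Lie}}(\mathfrak q)=\dfrac{\mathfrak r\cap[\mathfrak f,\mathfrak f]_{\mathsf{Lie}}}{[\mathfrak r,\mathfrak f]_{\mathsf{Lie}}}$ (independent of the presentation up to canonical isomorphism); it is functorial: $\mathrm{HL}_2^{\mathsf{Lie}}(\gamma)$ is induced by any lift of $\gamma$ to a homomorphism between the free Leibniz algebras of the presentations. For a $\mathsf{Lie}$-central extension $(g)$, $\theta(g):\mathrm{HL}_2^{\mathsf{Lie}}(\mathfrak q)\to\mathfrak n$ is the natural connecting homomorphism of the exact sequence $\mathfrak n\otimes\mathfrak g_{\mathsf{Lie}}\to\mathrm{HL}_2^{\mathsf{Lie}}(\mathfrak g)\to\mathrm{HL}_2^{\mathsf{Lie}}(\mathfrak q)\xrightarrow{\theta(g)}\mathfrak n\to\mathfrak g_{\mathsf{Lie}}\to\mathfrak q_{\mathsf{Lie}}\to0$ (with $\mathfrak g_{\mathsf{Lie}}=\mathfrak g/[\mathfrak g,\mathfrak g]_{\mathsf{Lie}}$): choosing a lift $\tilde\rho:\mathfrak f\to\mathfrak g$ of $\rho$ (so $\pi\tilde\rho=\rho$), it sends the class of $r\in\mathfrak r\cap[\mathfrak f,\mathfrak f]_{\mathsf{Lie}}$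 to $\chi^{-1}(\tilde\rho(r))$. Its image is $\mathfrak n\cap[\mathfrak g,\mathfrak g]_{\mathsf{Lie}}$ (identifying $\mathfrak n$ with $\chi(\mathfrak n)$), and $\theta'(g):\mathrm{HL}_2^{\mathsf{Lie}}(\mathfrak q)\to[\mathfrak g,\mathfrak g]_{\mathsf{Lie}}$ denotes the same map viewed with values in $[\mathfrak g,\mathfrak g]_{\mathsf{Lie}}$. *)

theory Defs
  imports Main "HOL.Vector_Spaces"
begin

section \<open>Leibniz algebras\<close>

text \<open>The underlying abelian group of an algebra is its type; the record adds scalar
  multiplication and bracket.\<close>

record ('k, 'a) alg =
  scale :: "'k \<Rightarrow> 'a \<Rightarrow> 'a"
  brk :: "'a \<Rightarrow> 'a \<Rightarrow> 'a"

locale leibniz_algebra = vector_space "scale L"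
  for L :: "('k::field, 'a::ab_group_add) alg" +
  assumes brk_add_left: "brk L (x + y) z = brk L x z + brk L y z"
    and brk_add_right: "brk L x (y + z) = brk L x y + brk L x z"
    and brk_scale_left: "brk L (scale L c x) y = scale L c (brk L x y)"
    and brk_scale_right: "brk L x (scale L c y) = scale L c (brk L x y)"
    and leibniz: "brk L x (brk L y z) = brk L (brk L x y) z - brk L (brk L x z) y"

locale leibniz_hom = A: leibniz_algebra A + B: leibniz_algebra B +
    Vector_Spaces.linear "scale A" "scale B" f
  for A :: "('k::field, 'a::ab_group_add) alg" and B :: "('k, 'b::ab_group_add) alg"
    and f :: "'a \<Rightarrow> 'b" +
  assumes hom_brk: "f (brk A x y) = brk B (f x) (f y)"

definition leibniz_iso ::
    "('k::field, 'a::ab_group_add) alg \<Rightarrow> ('k, 'b::ab_group_add) alg \<Rightarrow> ('a \<Rightarrow> 'b) \<Rightarrow> bool" where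
  "leibniz_iso A B f \<longleftrightarrow> leibniz_hom A B f \<and> bij f"

text \<open>Isomorphisms between subalgebras \<open>S\<close> of \<open>A\<close> and \<open>T\<close> of \<open>B\<close>; the values of \<open>f\<close>
  outside \<open>S\<close> are irrelevant.\<close>

definition leibniz_iso_on ::
    "('k::field, 'a::ab_group_add) alg \<Rightarrow> 'a set \<Rightarrow> ('k, 'b::ab_group_add) alg \<Rightarrow> 'b set
      \<Rightarrow> ('a \<Rightarrow> 'b) \<Rightarrow> bool" where
  "leibniz_iso_on A S B T f \<longleftrightarrow> bij_betw f S T \<and>
     (\<forall>x\<in>S. \<forall>y\<in>S. f (x + y) = f x + f y) \<and>
     (\<forall>c. \<forall>x\<in>S. f (scale A c x) = scale B c (f x)) \<and>
     (\<forall>x\<in>S. \<forall>y\<in>S. f (brk A x y) = brk B (f x) (f y))"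

definition two_sided_ideal :: "('k::field, 'a::ab_group_add) alg \<Rightarrow> 'a set \<Rightarrow> bool" where
  "two_sided_ideal L I \<longleftrightarrow> module.subspace (scale L) I \<and>
     (\<forall>x\<in>I. \<forall>y. brk L x y \<in> I \<and> brk L y x \<in> I)"

definition Lie_commutator ::
    "('k::field, 'a::ab_group_add) alg \<Rightarrow> 'a set \<Rightarrow> 'a set \<Rightarrow> 'a set" where
  "Lie_commutator L M N = two_sided_ideal L hull {brk L m n + brk L n m | m n. m \<in> M \<and> n \<in> N}"

definition Lie_center :: "('k::field, 'a::ab_group_add) alg \<Rightarrow> 'a set" where
  "Lie_center L = {z. \<forall>q. brk L q z + brk L z q = 0}"

definition ker :: "('a \<Rightarrow> 'b::zero) \<Rightarrow> 'a set" where
  "ker f = {x. f x = 0}"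


section \<open>Extensions and isoclinism\<close>

locale leibniz_extension = chi: leibniz_hom N G \<chi> + pi: leibniz_hom G Q \<pi>
  for N :: "('k::field, 'n::ab_group_add) alg" and G :: "('k, 'g::ab_group_add) alg"
    and Q :: "('k, 'q::ab_group_add) alg" and \<chi> :: "'n \<Rightarrow> 'g" and \<pi> :: "'g \<Rightarrow> 'q" +
  assumes inj_chi: "inj \<chi>"
    and exact: "range \<chi> = ker \<pi>"
    and surj_pi: "surj \<pi>"

locale Lie_central_extension = leibniz_extension +
  assumes central: "range \<chi> \<subseteq> Lie_center G"

definition commutator_map ::
    "('k, 'g::ab_group_add) alg \<Rightarrow> ('g \<Rightarrow> 'q) \<Rightarrow> 'q \<Rightarrow> 'q \<Rightarrow> 'g" where
  "commutator_map G \<pi> p q =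
     (THE c. \<exists>x y. \<pi> x = p \<and> \<pi> y = q \<and> c = brk G x y + brk G y x)"

definition Lie_isoclinism ::
    "('k::field, 'g1::ab_group_add) alg \<Rightarrow> ('k, 'q1::ab_group_add) alg \<Rightarrow> ('g1 \<Rightarrow> 'q1)
     \<Rightarrow> ('k, 'g2::ab_group_add) alg \<Rightarrow> ('k, 'q2::ab_group_add) alg \<Rightarrow> ('g2 \<Rightarrow> 'q2)
     \<Rightarrow> ('q1 \<Rightarrow> 'q2) \<Rightarrow> ('g1 \<Rightarrow> 'g2) \<Rightarrow> bool" where
  "Lie_isoclinism G1 Q1 \<pi>1 G2 Q2 \<pi>2 \<eta> \<xi> \<longleftrightarrow>
     leibniz_iso Q1 Q2 \<eta> \<and>
     leibniz_iso_on G1 (Lie_commutator G1 UNIV UNIV) G2 (Lie_commutator G2 UNIV UNIV) \<xi> \<and>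
     (\<forall>p q. \<xi> (commutator_map G1 \<pi>1 p q) = commutator_map G2 \<pi>2 (\<eta> p) (\<eta> q))"


section \<open>Free Leibniz algebras\<close>

text \<open>The free Leibniz algebra on a set is the algebra of formal terms over it, modulo the
  equations derivable from the axioms of Leibniz algebras. An algebra is free on a subset
  \<open>X\<close> if evaluation of terms over \<open>X\<close> identifies it with this quotient. The universal
  property, with targets of arbitrary type, is derived below as
  \<open>free_on_extend\<close> and \<open>free_on_unique\<close>.\<close>

datatype ('k, 'x) lterm =
    Var 'x
  | Zero
  | Plus "('k, 'x) lterm" "('k, 'x) lterm"
  | Scale 'k "('k, 'x) lterm"
  | Brk "('k, 'x) lterm" "('k, 'x) lterm"

primrec vars :: "('k, 'x) lterm \<Rightarrow> 'x set" where
  "vars (Var x) = {x}"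
| "vars Zero = {}"
| "vars (Plus s t) = vars s \<union> vars t"
| "vars (Scale c t) = vars t"
| "vars (Brk s t) = vars s \<union> vars t"

primrec eval_term ::
    "('k, 'a::ab_group_add) alg \<Rightarrow> ('x \<Rightarrow> 'a) \<Rightarrow> ('k, 'x) lterm \<Rightarrow> 'a" where
  "eval_term L v (Var x) = v x"
| "eval_term L v Zero = 0"
| "eval_term L v (Plus s t) = eval_term L v s + eval_term L v t"
| "eval_term L v (Scale c t) = scale L c (eval_term L v t)"
| "eval_term L v (Brk s t) = brk L (eval_term L v s) (eval_term L v t)"

inductive leibniz_eq :: "('k::field, 'x) lterm \<Rightarrow> ('k, 'x) lterm \<Rightarrow> bool" where
  eq_refl: "leibniz_eq t t"
| eq_sym: "leibniz_eq s t \<Longrightarrow> leibniz_eq t s"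
| eq_trans: "leibniz_eq s t \<Longrightarrow> leibniz_eq t u \<Longrightarrow> leibniz_eq s u"
| cong_Plus: "leibniz_eq s s' \<Longrightarrow> leibniz_eq t t' \<Longrightarrow> leibniz_eq (Plus s t) (Plus s' t')"
| cong_Scale: "leibniz_eq t t' \<Longrightarrow> leibniz_eq (Scale c t) (Scale c t')"
| cong_Brk: "leibniz_eq s s' \<Longrightarrow> leibniz_eq t t' \<Longrightarrow> leibniz_eq (Brk s t) (Brk s' t')"
| "leibniz_eq (Plus (Plus s t) u) (Plus s (Plus t u))"
| "leibniz_eq (Plus s t) (Plus t s)"
| "leibniz_eq (Plus Zero t) t"
| "leibniz_eq (Plus t (Scale (-1) t)) Zero"
| "leibniz_eq (Scale c (Plus s t)) (Plus (Scale c s) (Scale c t))"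
| "leibniz_eq (Scale (c + d) t) (Plus (Scale c t) (Scale d t))"
| "leibniz_eq (Scale c (Scale d t)) (Scale (c * d) t)"
| "leibniz_eq (Scale 1 t) t"
| "leibniz_eq (Brk (Plus s t) u) (Plus (Brk s u) (Brk t u))"
| "leibniz_eq (Brk s (Plus t u)) (Plus (Brk s t) (Brk s u))"
| "leibniz_eq (Brk (Scale c s) t) (Scale c (Brk s t))"
| "leibniz_eq (Brk s (Scale c t)) (Scale c (Brk s t))"
| "leibniz_eq (Brk s (Brk t u)) (Plus (Brk (Brk s t) u) (Scale (-1) (Brk (Brk s u) t)))"

definition free_on :: "('k::field, 'f::ab_group_add) alg \<Rightarrow> 'f set \<Rightarrow> bool" where
  "free_on F X \<longleftrightarrow> leibniz_algebra F \<and>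
     (\<forall>y. \<exists>t. vars t \<subseteq> X \<and> eval_term F id t = y) \<and>
     (\<forall>s t. vars s \<subseteq> X \<and> vars t \<subseteq> X \<and> eval_term F id s = eval_term F id t \<longrightarrow> leibniz_eq s t)"

definition free_leibniz :: "('k::field, 'f::ab_group_add) alg \<Rightarrow> bool" where
  "free_leibniz F \<longleftrightarrow> (\<exists>X. free_on F X)"

text \<open>A free presentation is given by its epimorphism \<open>\<rho>\<close>; the ideal \<open>\<rr>\<close> of relations is
  \<open>ker \<rho>\<close>.\<close>

locale free_presentation = leibniz_hom F Q \<rho>
  for F :: "('k::field, 'f::ab_group_add) alg" and Q :: "('k, 'q::ab_group_add) alg"
    and \<rho> :: "'f \<Rightarrow> 'q" +
  assumes free: "free_leibniz F"
    and surj_rho: "surj \<rho>"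


section \<open>Second Lie-homology and the connecting homomorphism\<close>

definition coset :: "'a::ab_group_add \<Rightarrow> 'a set \<Rightarrow> 'a set" where
  "coset x S = (\<lambda>s. x + s) ` S"

definition HL2_class ::
    "('k::field, 'f::ab_group_add) alg \<Rightarrow> ('f \<Rightarrow> 'q::ab_group_add) \<Rightarrow> 'f \<Rightarrow> 'f set" where
  "HL2_class F \<rho> r = coset r (Lie_commutator F (ker \<rho>) UNIV)"

definition HL2 ::
    "('k::field, 'f::ab_group_add) alg \<Rightarrow> ('f \<Rightarrow> 'q::ab_group_add) \<Rightarrow> 'f set set" where
  "HL2 F \<rho> = HL2_class F \<rho> ` (ker \<rho> \<inter> Lie_commutator F UNIV UNIV)"

text \<open>The descriptions below determine a unique value because they depend neither on the lift
  nor on the representative; see \<open>HL2_map_eq\<close> and \<open>theta_eq\<close>.\<close>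

definition HL2_map ::
    "('k::field, 'f1::ab_group_add) alg \<Rightarrow> ('f1 \<Rightarrow> 'q1::ab_group_add)
     \<Rightarrow> ('k, 'f2::ab_group_add) alg \<Rightarrow> ('f2 \<Rightarrow> 'q2::ab_group_add)
     \<Rightarrow> ('q1 \<Rightarrow> 'q2) \<Rightarrow> 'f1 set \<Rightarrow> 'f2 set" where
  "HL2_map F1 \<rho>1 F2 \<rho>2 \<gamma> c =
     (THE d. \<exists>\<phi>. leibniz_hom F1 F2 \<phi> \<and> \<rho>2 \<circ> \<phi> = \<gamma> \<circ> \<rho>1 \<and> (\<exists>r\<in>c. d = HL2_class F2 \<rho>2 (\<phi> r)))"

definition theta ::
    "('k::field, 'f::ab_group_add) alg \<Rightarrow> ('f \<Rightarrow> 'q::ab_group_add)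
     \<Rightarrow> ('k, 'g::ab_group_add) alg \<Rightarrow> ('n::ab_group_add \<Rightarrow> 'g) \<Rightarrow> ('g \<Rightarrow> 'q)
     \<Rightarrow> 'f set \<Rightarrow> 'n" where
  "theta F \<rho> G \<chi> \<pi> c =
     (THE n. \<exists>\<rho>'. leibniz_hom F G \<rho>' \<and> \<pi> \<circ> \<rho>' = \<rho> \<and> (\<exists>r\<in>c. \<chi> n = \<rho>' r))"

definition theta' ::
    "('k::field, 'f::ab_group_add) alg \<Rightarrow> ('f \<Rightarrow> 'q::ab_group_add)
     \<Rightarrow> ('k, 'g::ab_group_add) alg \<Rightarrow> ('n::ab_group_add \<Rightarrow> 'g) \<Rightarrow> ('g \<Rightarrow> 'q)
     \<Rightarrow> 'f set \<Rightarrow> 'g" where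
  "theta' F \<rho> G \<chi> \<pi> c = \<chi> (theta F \<rho> G \<chi> \<pi> c)"

definition ker_theta ::
    "('k::field, 'f::ab_group_add) alg \<Rightarrow> ('f \<Rightarrow> 'q::ab_group_add)
     \<Rightarrow> ('k, 'g::ab_group_add) alg \<Rightarrow> ('n::ab_group_add \<Rightarrow> 'g) \<Rightarrow> ('g \<Rightarrow> 'q)
     \<Rightarrow> 'f set set" where
  "ker_theta F \<rho> G \<chi> \<pi> = {c \<in> HL2 F \<rho>. theta F \<rho> G \<chi> \<pi> c = 0}"


section \<open>The universal property and well-definedness\<close>

context leibniz_algebra
begin

lemma brk_zero_left [simp]: "brk L 0 y = 0"
  using brk_add_left[of 0 0 y] by simp

lemma brk_zero_right [simp]: "brk L x 0 = 0"
  using brk_add_right[of x 0 0] by simp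

lemma brk_minus_left: "brk L (- x) y = - brk L x y"
  using brk_add_left[of "-x" x y] by (simp add: eq_neg_iff_add_eq_0)

lemma brk_minus_right: "brk L x (- y) = - brk L x y"
  using brk_add_right[of x "-y" y] by (simp add: eq_neg_iff_add_eq_0)

lemma brk_diff_left: "brk L (x - y) z = brk L x z - brk L y z"
  using brk_add_left[of x "-y" z] by (simp add: brk_minus_left)

lemma brk_diff_right: "brk L x (y - z) = brk L x y - brk L x z"
  using brk_add_right[of x y "-z"] by (simp add: brk_minus_right)

lemma brk_sym_right: "brk L x (brk L y z + brk L z y) = 0"
  by (simp add: brk_add_right leibniz)

lemma eval_term_sound: "leibniz_eq s t \<Longrightarrow> eval_term L v s = eval_term L v t"
  by (induction rule: leibniz_eq.induct)
    (simp_all add: brk_add_left brk_add_right brk_scale_left brk_scale_right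
      scale_right_distrib scale_left_distrib leibniz add_ac)

lemma ideal_hull: "two_sided_ideal L (two_sided_ideal L hull S)"
proof (rule hull_in)
  fix T assume "Ball T (two_sided_ideal L)"
  then show "two_sided_ideal L (\<Inter> T)"
    by (auto simp: two_sided_ideal_def subspace_def)
qed

lemma ideal_Lie_commutator: "two_sided_ideal L (Lie_commutator L M N)"
  unfolding Lie_commutator_def by (rule ideal_hull)

lemma Lie_commutator_subset:
  assumes "two_sided_ideal L I"
    and "\<And>m n. m \<in> M \<Longrightarrow> n \<in> N \<Longrightarrow> brk L m n + brk L n m \<in> I"
  shows "Lie_commutator L M N \<subseteq> I"
  unfolding Lie_commutator_def using assms by (intro hull_minimal) auto

lemma Lie_commutator_gen:
  "m \<in> M \<Longrightarrow> n \<in> N \<Longrightarrow> brk L m n + brk L n m \<in> Lie_commutator L M N"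
  unfolding Lie_commutator_def by (rule hull_inc) auto

lemma ideal_zero: "two_sided_ideal L {0}"
  by (auto simp: two_sided_ideal_def subspace_def)

end

lemma two_sided_idealD:
  assumes "two_sided_ideal L I" and "leibniz_algebra L"
  shows "0 \<in> I" "\<And>x y. x \<in> I \<Longrightarrow> y \<in> I \<Longrightarrow> x + y \<in> I" "\<And>c x. x \<in> I \<Longrightarrow> scale L c x \<in> I"
    "\<And>x y. x \<in> I \<Longrightarrow> y \<in> I \<Longrightarrow> x - y \<in> I"
    "\<And>x y. x \<in> I \<Longrightarrow> brk L x y \<in> I" "\<And>x y. x \<in> I \<Longrightarrow> brk L y x \<in> I"
proof -
  interpret leibniz_algebra L by fact
  have I: "subspace I" using assms(1) by (simp add: two_sided_ideal_def)
  show "0 \<in> I" "\<And>x y. x \<in> I \<Longrightarrow> y \<in> I \<Longrightarrow> x + y \<in> I" "\<And>c x. x \<in> I \<Longrightarrow> scale L c x \<in> I"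
    "\<And>x y. x \<in> I \<Longrightarrow> y \<in> I \<Longrightarrow> x - y \<in> I"
    using I by (auto intro: subspace_0 subspace_add subspace_scale subspace_diff)
  show "\<And>x y. x \<in> I \<Longrightarrow> brk L x y \<in> I" "\<And>x y. x \<in> I \<Longrightarrow> brk L y x \<in> I"
    using assms(1) by (auto simp: two_sided_ideal_def)
qed

context leibniz_hom
begin

lemma ideal_vimage:
  assumes "two_sided_ideal B I"
  shows "two_sided_ideal A (f -` I)"
  using two_sided_idealD[OF assms B.leibniz_algebra_axioms]
  by (auto simp: two_sided_ideal_def A.subspace_def add scale zero hom_brk)

lemma ideal_ker: "two_sided_ideal A (ker f)"
  using ideal_vimage[OF B.ideal_zero] by (simp add: ker_def vimage_def)

lemma Lie_commutator_image:
  assumes "f ` M \<subseteq> M'" and "f ` N \<subseteq> N'"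
  shows "f ` Lie_commutator A M N \<subseteq> Lie_commutator B M' N'"
proof -
  have "Lie_commutator A M N \<subseteq> f -` Lie_commutator B M' N'"
    using assms
    by (intro A.Lie_commutator_subset ideal_vimage B.ideal_Lie_commutator)
      (auto simp: add hom_brk intro: B.Lie_commutator_gen)
  then show ?thesis by auto
qed

text \<open>Homomorphisms that agree modulo \<open>J\<close> agree on \<open>[A, A]\<^sub>L\<^sub>i\<^sub>e\<close> modulo \<open>[J, B]\<^sub>L\<^sub>i\<^sub>e\<close>.\<close>

lemma hom_diff_Lie_commutator:
  assumes "leibniz_hom A B g" and diff: "\<And>x. f x - g x \<in> J"
    and r: "r \<in> Lie_commutator A UNIV UNIV"
  shows "f r - g r \<in> Lie_commutator B J UNIV"
proof -
  interpret g: leibniz_hom A B g by fact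
  let ?K = "Lie_commutator B J UNIV"
  let ?P = "{r. f r - g r \<in> ?K \<and> (\<forall>y. brk B y (g r) = 0)}"
  note K = two_sided_idealD[OF B.ideal_Lie_commutator[of J UNIV] B.leibniz_algebra_axioms]
  have sub: "A.subspace ?P"
    unfolding A.subspace_def
  proof (intro conjI allI ballI)
    show "0 \<in> ?P" using K(1) by (simp add: zero g.zero)
  next
    fix x y assume P: "x \<in> ?P" "y \<in> ?P"
    have "f (x + y) - g (x + y) = (f x - g x) + (f y - g y)"
      by (simp add: add g.add)
    also have "\<dots> \<in> ?K" using P by (auto intro: K(2))
    finally show "x + y \<in> ?P" using P by (simp add: g.add B.brk_add_right)
  next
    fix c x assume P: "x \<in> ?P"
    have "f (scale A c x) - g (scale A c x) = scale B c (f x - g x)"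
      by (simp add: scale g.scale B.scale_right_diff_distrib)
    also have "\<dots> \<in> ?K" using P by (auto intro: K(3))
    finally show "scale A c x \<in> ?P" using P by (simp add: g.scale B.brk_scale_right)
  qed
  have br: "brk A x y \<in> ?P \<and> brk A y x \<in> ?P" if x: "x \<in> ?P" for x y
  proof
    have "brk B (f y - g y) (g x) + brk B (g x) (f y - g y) \<in> ?K"
      using diff by (intro B.Lie_commutator_gen) auto
    then have *: "brk B (g x) (f y - g y) \<in> ?K" using x by simp
    have "f (brk A x y) - g (brk A x y) = brk B (f x - g x) (f y) + brk B (g x) (f y - g y)"
      by (simp add: hom_brk g.hom_brk B.brk_diff_left B.brk_diff_right)
    then have "f (brk A x y) - g (brk A x y) \<in> ?K"
      using K(2)[OF K(5) *] x by simp
    then show "brk A x y \<in> ?P" using x by (simp add: g.hom_brk B.leibniz)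
    have "f (brk A y x) - g (brk A y x) = brk B (f y) (f x - g x) + brk B (f y - g y) (g x)"
      by (simp add: hom_brk g.hom_brk B.brk_diff_left B.brk_diff_right)
    then show "brk A y x \<in> ?P" using x K(6) by (simp add: g.hom_brk)
  qed
  have "Lie_commutator A UNIV UNIV \<subseteq> ?P"
  proof (rule A.Lie_commutator_subset)
    show "two_sided_ideal A ?P" using sub br by (simp add: two_sided_ideal_def)
  next
    fix m n
    have "f (brk A m n + brk A n m) - g (brk A m n + brk A n m) =
      (brk B (f m - g m) (f n) + brk B (f n) (f m - g m)) +
      (brk B (f n - g n) (g m) + brk B (g m) (f n - g n))"
      by (simp add: add g.add hom_brk g.hom_brk B.brk_diff_left B.brk_diff_right)
    also have "\<dots> \<in> ?K" using diff by (intro K(2) B.Lie_commutator_gen) auto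
    finally show "brk A m n + brk A n m \<in> ?P"
      using B.brk_sym_right by (simp add: g.add g.hom_brk)
  qed
  then show ?thesis using r by auto
qed

end

theorem free_on_extend:
  fixes F :: "('k::field, 'f::ab_group_add) alg" and H :: "('k, 'h::ab_group_add) alg"
  assumes "free_on F X" and "leibniz_algebra H"
  shows "\<exists>h. leibniz_hom F H h \<and> (\<forall>x\<in>X. h x = g x)"
proof -
  interpret F: leibniz_algebra F using assms(1) by (simp add: free_on_def)
  interpret H: leibniz_algebra H by fact
  have "\<forall>y. \<exists>t. vars t \<subseteq> X \<and> eval_term F id t = y"
    using assms(1) by (simp add: free_on_def)
  then obtain T where T: "\<And>y. vars (T y) \<subseteq> X" "\<And>y. eval_term F id (T y) = y"
    by metis
  define h where "h y = eval_term H g (T y)" for y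
  have h: "h (eval_term F id t) = eval_term H g t" if "vars t \<subseteq> X" for t
  proof -
    have "leibniz_eq (T (eval_term F id t)) t"
      using assms(1) that T unfolding free_on_def by blast
    then show ?thesis unfolding h_def by (rule H.eval_term_sound)
  qed
  have "leibniz_hom F H h"
  proof unfold_locales
    fix x y c
    show "h (x + y) = h x + h y" using h[of "Plus (T x) (T y)"] T by (simp add: h_def)
    show "h (scale F c x) = scale H c (h x)" using h[of "Scale c (T x)"] T by (simp add: h_def)
    show "h (brk F x y) = brk H (h x) (h y)" using h[of "Brk (T x) (T y)"] T by (simp add: h_def)
  qed
  moreover have "h x = g x" if "x \<in> X" for x using h[of "Var x"] that by simp
  ultimately show ?thesis by blast
qed

theorem free_on_unique:
  assumes "free_on F X" and "leibniz_hom F H h" and "leibniz_hom F H h'"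
    and "\<And>x. x \<in> X \<Longrightarrow> h x = h' x"
  shows "h = h'"
proof
  interpret h: leibniz_hom F H h by fact
  interpret h': leibniz_hom F H h' by fact
  fix y
  obtain t where t: "vars t \<subseteq> X" "eval_term F id t = y"
    using assms(1) unfolding free_on_def by blast
  have "h (eval_term F id t) = h' (eval_term F id t)"
    using t(1) assms(4)
    by (induction t)
      (auto simp: h.zero h'.zero h.add h'.add h.scale h'.scale h.hom_brk h'.hom_brk)
  then show "h y = h' y" using t by simp
qed

lemma lift_exists:
  assumes "free_leibniz F" and "leibniz_hom G Q \<pi>" and "surj \<pi>" and "leibniz_hom F Q \<rho>"
  shows "\<exists>\<phi>. leibniz_hom F G \<phi> \<and> \<pi> \<circ> \<phi> = \<rho>"
proof -
  interpret pi: leibniz_hom G Q \<pi> by fact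
  interpret rho: leibniz_hom F Q \<rho> by fact
  obtain X where X: "free_on F X" using assms(1) by (auto simp: free_leibniz_def)
  obtain \<phi> where \<phi>: "leibniz_hom F G \<phi>" "\<And>x. x \<in> X \<Longrightarrow> \<phi> x = inv \<pi> (\<rho> x)"
    using free_on_extend[OF X pi.A.leibniz_algebra_axioms, of "\<lambda>x. inv \<pi> (\<rho> x)"] by blast
  interpret phi: leibniz_hom F G \<phi> by fact
  have "leibniz_hom F Q (\<pi> \<circ> \<phi>)"
    by unfold_locales
      (simp_all add: phi.add pi.add phi.scale pi.scale phi.hom_brk pi.hom_brk)
  then have "\<pi> \<circ> \<phi> = \<rho>"
    using free_on_unique[OF X _ assms(4)] \<phi>(2) surj_f_inv_f[OF assms(3)] by auto
  then show ?thesis using \<phi>(1) by blast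
qed

context free_presentation
begin

lemma relations_subset: "Lie_commutator F (ker \<rho>) UNIV \<subseteq> ker \<rho> \<inter> Lie_commutator F UNIV UNIV"
proof -
  note K = two_sided_idealD[OF ideal_ker A.leibniz_algebra_axioms]
  have "Lie_commutator F (ker \<rho>) UNIV \<subseteq> ker \<rho>"
    using K by (intro A.Lie_commutator_subset ideal_ker) auto
  moreover have "Lie_commutator F (ker \<rho>) UNIV \<subseteq> Lie_commutator F UNIV UNIV"
    by (intro A.Lie_commutator_subset A.ideal_Lie_commutator A.Lie_commutator_gen) auto
  ultimately show ?thesis by blast
qed

lemma self_in_class: "r \<in> HL2_class F \<rho> r"
  using two_sided_idealD(1)[OF A.ideal_Lie_commutator A.leibniz_algebra_axioms]
  by (force simp: HL2_class_def coset_def)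

lemma class_eq_iff:
  "HL2_class F \<rho> x = HL2_class F \<rho> y \<longleftrightarrow> x - y \<in> Lie_commutator F (ker \<rho>) UNIV"
proof
  note K = two_sided_idealD[OF A.ideal_Lie_commutator A.leibniz_algebra_axioms]
  show "x - y \<in> Lie_commutator F (ker \<rho>) UNIV" if "HL2_class F \<rho> x = HL2_class F \<rho> y"
    using self_in_class[of x] unfolding that by (auto simp: HL2_class_def coset_def)
  assume d: "x - y \<in> Lie_commutator F (ker \<rho>) UNIV"
  have "x + s \<in> HL2_class F \<rho> y" "y + s \<in> HL2_class F \<rho> x"
    if s: "s \<in> Lie_commutator F (ker \<rho>) UNIV" for s
    using K(2)[OF d s] K(4)[OF s d]
    by (auto simp: HL2_class_def coset_def algebra_simps intro: image_eqI[rotated])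
  then show "HL2_class F \<rho> x = HL2_class F \<rho> y"
    by (auto simp: HL2_class_def coset_def)
qed

end

theorem HL2_map_eq:
  assumes "free_presentation F1 Q1 \<rho>1" and "free_presentation F2 Q2 \<rho>2"
    and "leibniz_hom Q1 Q2 \<gamma>"
    and "leibniz_hom F1 F2 \<phi>" and "\<rho>2 \<circ> \<phi> = \<gamma> \<circ> \<rho>1"
    and r: "r \<in> ker \<rho>1 \<inter> Lie_commutator F1 UNIV UNIV"
  shows "HL2_map F1 \<rho>1 F2 \<rho>2 \<gamma> (HL2_class F1 \<rho>1 r) = HL2_class F2 \<rho>2 (\<phi> r)"
proof -
  interpret p1: free_presentation F1 Q1 \<rho>1 by fact
  interpret p2: free_presentation F2 Q2 \<rho>2 by fact
  interpret g: leibniz_hom Q1 Q2 \<gamma> by fact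
  interpret phi: leibniz_hom F1 F2 \<phi> by fact
  have "HL2_class F2 \<rho>2 (\<psi> r') = HL2_class F2 \<rho>2 (\<phi> r)"
    if \<psi>: "leibniz_hom F1 F2 \<psi>" "\<rho>2 \<circ> \<psi> = \<gamma> \<circ> \<rho>1" and r': "r' \<in> HL2_class F1 \<rho>1 r" for \<psi> r'
  proof -
    interpret psi: leibniz_hom F1 F2 \<psi> by fact
    let ?K = "Lie_commutator F2 (ker \<rho>2) UNIV"
    obtain s where s: "s \<in> Lie_commutator F1 (ker \<rho>1) UNIV" "r' = r + s"
      using r' by (auto simp: HL2_class_def coset_def)
    have "\<psi> ` ker \<rho>1 \<subseteq> ker \<rho>2"
      using fun_cong[OF \<psi>(2)] by (auto simp: ker_def g.zero)
    then have "\<psi> s \<in> ?K" using psi.Lie_commutator_image[of "ker \<rho>1" "ker \<rho>2" UNIV UNIV] s by auto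
    moreover have "\<psi> r - \<phi> r \<in> ?K"
    proof (rule psi.hom_diff_Lie_commutator)
      show "\<psi> x - \<phi> x \<in> ker \<rho>2" for x
        using fun_cong[OF \<psi>(2), of x] fun_cong[OF assms(5), of x] by (simp add: ker_def p2.diff)
    qed (use assms(4) r in auto)
    ultimately have "(\<psi> r - \<phi> r) + \<psi> s \<in> ?K"
      by (intro two_sided_idealD(2)[OF p2.A.ideal_Lie_commutator p2.A.leibniz_algebra_axioms])
    then show ?thesis by (simp add: p2.class_eq_iff s psi.add algebra_simps)
  qed
  then show ?thesis
    unfolding HL2_map_def using assms(4,5) p1.self_in_class[of r]
    by (intro the_equality) blast+
qed

theorem theta_eq:
  assumes "Lie_central_extension N G Q \<chi> \<pi>" and "free_presentation F Q \<rho>"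
    and "leibniz_hom F G \<rho>'" and "\<pi> \<circ> \<rho>' = \<rho>"
    and r: "r \<in> ker \<rho> \<inter> Lie_commutator F UNIV UNIV"
  shows "\<chi> (theta F \<rho> G \<chi> \<pi> (HL2_class F \<rho> r)) = \<rho>' r"
proof -
  interpret e: Lie_central_extension N G Q \<chi> \<pi> by fact
  interpret p: free_presentation F Q \<rho> by fact
  interpret l: leibniz_hom F G \<rho>' by fact
  have triv: "Lie_commutator G (ker \<pi>) UNIV \<subseteq> {0}"
    using e.central unfolding e.exact
    by (intro e.chi.B.Lie_commutator_subset e.chi.B.ideal_zero)
      (auto simp: Lie_center_def add.commute)
  have *: "\<psi> r' = \<rho>' r"
    if \<psi>: "leibniz_hom F G \<psi>" "\<pi> \<circ> \<psi> = \<rho>" and r': "r' \<in> HL2_class F \<rho> r" for \<psi> r'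
  proof -
    interpret psi: leibniz_hom F G \<psi> by fact
    obtain s where s: "s \<in> Lie_commutator F (ker \<rho>) UNIV" "r' = r + s"
      using r' by (auto simp: HL2_class_def coset_def)
    have "\<psi> ` ker \<rho> \<subseteq> ker \<pi>" using fun_cong[OF \<psi>(2)] by (auto simp: ker_def)
    then have "\<psi> s = 0"
      using psi.Lie_commutator_image[of "ker \<rho>" "ker \<pi>" UNIV UNIV] s triv by auto
    moreover have "\<psi> r - \<rho>' r \<in> Lie_commutator G (ker \<pi>) UNIV"
    proof (rule psi.hom_diff_Lie_commutator)
      show "\<psi> x - \<rho>' x \<in> ker \<pi>" for x
        using fun_cong[OF \<psi>(2), of x] fun_cong[OF assms(4), of x] by (simp add: ker_def e.pi.diff)
    qed (use assms(3) r in auto)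
    ultimately show ?thesis using triv by (auto simp: s psi.add)
  qed
  have "\<rho>' r \<in> ker \<pi>" using r fun_cong[OF assms(4), of r] by (simp add: ker_def)
  then obtain n where n: "\<chi> n = \<rho>' r" using e.exact by (metis rangeE)
  have "theta F \<rho> G \<chi> \<pi> (HL2_class F \<rho> r) = n"
    unfolding theta_def
  proof (rule the_equality)
    show "\<exists>\<psi>. leibniz_hom F G \<psi> \<and> \<pi> \<circ> \<psi> = \<rho> \<and> (\<exists>r'\<in>HL2_class F \<rho> r. \<chi> n = \<psi> r')"
      using assms(3,4) n p.self_in_class[of r] by blast
  next
    fix m
    assume "\<exists>\<psi>. leibniz_hom F G \<psi> \<and> \<pi> \<circ> \<psi> = \<rho> \<and> (\<exists>r'\<in>HL2_class F \<rho> r. \<chi> m = \<psi> r')"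
    then have "\<chi> m = \<chi> n" using * n by auto
    then show "m = n" using e.inj_chi by (auto dest: injD)
  qed
  then show ?thesis using n by simp
qed

end

theory Submission
  imports Defs
begin

text \<open>A symmetrised bracket \<open>[x, y] + [y, x]\<close> is annihilated by brackets from the left, and so is the
  ideal \<open>[\<gg>, \<gg>]\<^sub>L\<^sub>i\<^sub>e\<close>; hence \<open>[d, x] = [d, x] + [x, d]\<close> for \<open>d\<close> in this ideal. Two consequences carry
  the proof. First, a homomorphism onto a Leibniz algebra modulo its Lie-centre maps one ideal
  \<open>[-, -]\<^sub>L\<^sub>i\<^sub>e\<close> onto the other. Second, an isoclinism \<open>\<xi>\<close>, although only defined on
  \<open>[\<gg>\<^sub>1, \<gg>\<^sub>1]\<^sub>L\<^sub>i\<^sub>e\<close>, is compatible with brackets by arbitrary elements of \<open>\<gg>\<^sub>1\<close>.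

  Choose a lift \<open>\<mu> : \<ff>\<^sub>1 \<rightarrow> \<gg>\<^sub>1\<close> of \<open>\<rho>\<^sub>1\<close> and a lift \<open>\<sigma> : \<ff>\<^sub>1 \<rightarrow> \<gg>\<^sub>2\<close> of \<open>\<eta> \<circ> \<rho>\<^sub>1\<close> through \<open>\<ff>\<^sub>2\<close>.
  Both map \<open>[\<ff>\<^sub>1, \<ff>\<^sub>1]\<^sub>L\<^sub>i\<^sub>e\<close> onto \<open>[\<gg>\<^sub>i, \<gg>\<^sub>i]\<^sub>L\<^sub>i\<^sub>e\<close>, and all three statements say that \<open>\<mu>\<close> and \<open>\<sigma>\<close> have the
  same kernel there.\<close>

section \<open>Brackets of \<open>[L, L]_Lie\<close> with arbitrary and with Lie-central
  elements\<close>

context leibniz_algebra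
begin

text \<open>The elements \<open>d\<close> with \<open>[y, d] = 0\<close> for all \<open>y\<close>
  form a two-sided ideal: in \<open>[y, [d, x]] = [[y, d], x] - [[y, x], d]\<close> both terms on
  the right vanish.\<close>

lemma brk_Lie_commutator_right:
  assumes "d \<in> Lie_commutator L UNIV UNIV"
  shows "brk L y d = 0"
proof -
  have "two_sided_ideal L {d. \<forall>y. brk L y d = 0}"
    by (auto simp: two_sided_ideal_def subspace_def brk_add_right brk_scale_right leibniz)
  then have "Lie_commutator L UNIV UNIV \<subseteq> {d. \<forall>y. brk L y d = 0}"
    using brk_sym_right by (intro Lie_commutator_subset) auto
  then show ?thesis using assms by auto
qed

text \<open>Since \<open>[z, d]\<close> vanishes already, the central relation leaves only
  \<open>[d, z]\<close>. Hence \<open>[d, y]\<close> depends on \<open>y\<close> only modulo the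
  Lie-centre.\<close>

lemma brk_Lie_commutator_Lie_center:
  assumes "d \<in> Lie_commutator L UNIV UNIV" and "z \<in> Lie_center L"
  shows "brk L d z = 0"
proof -
  have "brk L z d + brk L d z = 0"
    using assms(2) by (simp add: Lie_center_def add.commute[of "brk L z d"])
  then show ?thesis using brk_Lie_commutator_right[OF assms(1)] by simp
qed

text \<open>The difference of the two sides splits into two symmetrised brackets, each with a
  central factor. This makes the commutator map independent of the chosen preimages.\<close>

lemma sym_brk_cong_Lie_center:
  assumes "x - x' \<in> Lie_center L" and "y - y' \<in> Lie_center L"
  shows "brk L x y + brk L y x = brk L x' y' + brk L y' x'"
proof -
  have "brk L x y + brk L y x - (brk L x' y' + brk L y' x') =
    (brk L y (x - x') + brk L (x - x') y) + (brk L x' (y - y') + brk L (y - y') x')"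
    by (simp add: brk_diff_left brk_diff_right)
  also have "\<dots> = 0" using assms by (simp add: Lie_center_def)
  finally show ?thesis by simp
qed

end

context leibniz_hom
begin

text \<open>The image of an ideal need not be an ideal when \<open>f\<close> is not onto. Here it
  is: \<open>[f d, y]\<close> is unchanged when \<open>y\<close> is replaced by some
  \<open>f x\<close> congruent to it modulo the Lie-centre, and \<open>[y, f d] = 0\<close>.\<close>

lemma Lie_commutator_image_eq:
  assumes onto: "\<And>y. \<exists>x. y - f x \<in> Lie_center B"
  shows "f ` Lie_commutator A UNIV UNIV = Lie_commutator B UNIV UNIV" (is "f ` ?D = ?E")
proof
  show le: "f ` ?D \<subseteq> ?E" by (rule Lie_commutator_image) auto
  note D = two_sided_idealD[OF A.ideal_Lie_commutator[of UNIV UNIV] A.leibniz_algebra_axioms]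
  have "A.subspace ?D" using A.ideal_Lie_commutator by (simp add: two_sided_ideal_def)
  then have "B.subspace (f ` ?D)" by (rule subspace_image)
  moreover have "brk B (f d) y \<in> f ` ?D" "brk B y (f d) \<in> f ` ?D" if d: "d \<in> ?D" for d y
  proof -
    have fd: "f d \<in> ?E" using le d by blast
    obtain x where "y - f x \<in> Lie_center B" using onto by blast
    from B.brk_Lie_commutator_Lie_center[OF fd this]
    have "brk B (f d) y = f (brk A d x)" by (simp add: hom_brk B.brk_diff_right)
    then show "brk B (f d) y \<in> f ` ?D" using D(5)[OF d] by auto
    show "brk B y (f d) \<in> f ` ?D"
      using B.brk_Lie_commutator_right[OF fd] imageI[OF D(1), of f] by (simp add: zero)
  qed
  ultimately have "two_sided_ideal B (f ` ?D)" by (auto simp: two_sided_ideal_def)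
  then show "?E \<subseteq> f ` ?D"
  proof (rule B.Lie_commutator_subset)
    fix m n
    obtain a b where ab: "m - f a \<in> Lie_center B" "n - f b \<in> Lie_center B"
      using onto by blast
    have "brk B m n + brk B n m = f (brk A a b + brk A b a)"
      using B.sym_brk_cong_Lie_center[OF ab] by (simp add: add hom_brk)
    then show "brk B m n + brk B n m \<in> f ` ?D" using A.Lie_commutator_gen by auto
  qed
qed

end

section \<open>Composites and inverses of homomorphisms\<close>

lemma leibniz_hom_comp:
  assumes "leibniz_hom A B f" and "leibniz_hom B C g"
  shows "leibniz_hom A C (g \<circ> f)"
proof -
  interpret f: leibniz_hom A B f by fact
  interpret g: leibniz_hom B C g by fact
  show ?thesis
    by unfold_locales (simp_all add: f.add g.add f.scale g.scale f.hom_brk g.hom_brk)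
qed

lemma leibniz_hom_id:
  assumes "leibniz_algebra A"
  shows "leibniz_hom A A id"
proof -
  interpret leibniz_algebra A by fact
  show ?thesis by unfold_locales simp_all
qed

lemma leibniz_iso_inv:
  assumes "leibniz_iso A B f"
  shows "leibniz_iso B A (inv f)"
proof -
  interpret leibniz_hom A B f using assms by (simp add: leibniz_iso_def)
  have f: "bij f" using assms by (simp add: leibniz_iso_def)
  then have r: "f (inv f y) = y" for y by (simp add: bij_is_surj surj_f_inv_f)
  \<comment> \<open>Reduces each law for \<open>inv f\<close> to an equation between images under
    \<open>f\<close>.\<close>
  have e: "inv f y = x" if "y = f x" for x y using f that by (simp add: bij_is_inj)
  have "leibniz_hom B A (inv f)"
    by unfold_locales (rule e, simp add: add scale hom_brk r)+
  then show ?thesis using f by (simp add: leibniz_iso_def bij_imp_bij_inv)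
qed

section \<open>Commutator maps and lifts for Lie-central extensions\<close>

lemma (in Lie_central_extension) diff_in_Lie_center:
  "\<pi> x = \<pi> y \<Longrightarrow> x - y \<in> Lie_center G"
  using central exact by (auto simp: ker_def pi.diff)

lemma (in Lie_central_extension) commutator_map_eq:
  "commutator_map G \<pi> (\<pi> x) (\<pi> y) = brk G x y + brk G y x"
  unfolding commutator_map_def
proof (rule the_equality)
  fix c
  assume "\<exists>a b. \<pi> a = \<pi> x \<and> \<pi> b = \<pi> y \<and> c = brk G a b + brk G b a"
  then obtain a b where "\<pi> a = \<pi> x" "\<pi> b = \<pi> y" and c: "c = brk G a b + brk G b a"
    by blast
  then show "c = brk G x y + brk G y x"
    unfolding c by (intro chi.B.sym_brk_cong_Lie_center diff_in_Lie_center)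
qed blast

text \<open>Surjectivity onto the quotient suffices: every \<open>y\<close> is then some
  \<open>h x\<close> up to an element of \<open>ker \<pi>\<close>, which lies in the
  Lie-centre.\<close>

lemma (in Lie_central_extension) Lie_commutator_lift_image:
  assumes "leibniz_hom F G h" and "surj (\<pi> \<circ> h)"
  shows "h ` Lie_commutator F UNIV UNIV = Lie_commutator G UNIV UNIV"
proof -
  interpret h: leibniz_hom F G h by fact
  show ?thesis
  proof (rule h.Lie_commutator_image_eq)
    fix y
    obtain x where "\<pi> y = (\<pi> \<circ> h) x" using assms(2) by (metis surjD)
    then show "\<exists>x. y - h x \<in> Lie_center G" using diff_in_Lie_center by auto
  qed
qed

section \<open>Bijectivity of the map induced on second Lie-homology by an isomorphism\<close>

context
  fixes F1 :: "('k::field, 'f1::ab_group_add) alg" and Q1 :: "('k, 'q1::ab_group_add) alg"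
    and F2 :: "('k, 'f2::ab_group_add) alg" and Q2 :: "('k, 'q2::ab_group_add) alg"
    and \<rho>1 \<rho>2 \<eta>
  assumes p1: "free_presentation F1 Q1 \<rho>1" and p2: "free_presentation F2 Q2 \<rho>2"
    and iso: "leibniz_iso Q1 Q2 \<eta>"
begin

lemma HL2_map_in_HL2:
  assumes "c \<in> HL2 F1 \<rho>1"
  shows "HL2_map F1 \<rho>1 F2 \<rho>2 \<eta> c \<in> HL2 F2 \<rho>2"
proof -
  interpret p1: free_presentation F1 Q1 \<rho>1 by (rule p1)
  interpret p2: free_presentation F2 Q2 \<rho>2 by (rule p2)
  interpret eta: leibniz_hom Q1 Q2 \<eta> using iso by (simp add: leibniz_iso_def)
  obtain \<phi> where \<phi>: "leibniz_hom F1 F2 \<phi>" "\<rho>2 \<circ> \<phi> = \<eta> \<circ> \<rho>1"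
    using lift_exists[OF p1.free p2.leibniz_hom_axioms p2.surj_rho
        leibniz_hom_comp[OF p1.leibniz_hom_axioms eta.leibniz_hom_axioms]] by blast
  interpret phi: leibniz_hom F1 F2 \<phi> by fact
  obtain r where r: "r \<in> ker \<rho>1 \<inter> Lie_commutator F1 UNIV UNIV" "c = HL2_class F1 \<rho>1 r"
    using assms by (auto simp: HL2_def)
  have "\<phi> r \<in> ker \<rho>2 \<inter> Lie_commutator F2 UNIV UNIV"
    using r(1) fun_cong[OF \<phi>(2), of r] phi.Lie_commutator_image[of UNIV UNIV UNIV UNIV]
    by (auto simp: ker_def eta.zero)
  then show ?thesis
    using HL2_map_eq[OF p1 p2 eta.leibniz_hom_axioms \<phi> r(1)] r(2) by (simp add: HL2_def)
qed

text \<open>The composite \<open>\<psi> \<circ> \<phi>\<close> of the two lifts covers the identity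
  of \<open>Q1\<close>, so it agrees with \<open>id\<close> modulo \<open>ker \<rho>1\<close> and
  therefore induces the same map on classes.\<close>

lemma HL2_map_inv:
  assumes "c \<in> HL2 F1 \<rho>1"
  shows "HL2_map F2 \<rho>2 F1 \<rho>1 (inv \<eta>) (HL2_map F1 \<rho>1 F2 \<rho>2 \<eta> c) = c"
proof -
  interpret p1: free_presentation F1 Q1 \<rho>1 by (rule p1)
  interpret p2: free_presentation F2 Q2 \<rho>2 by (rule p2)
  interpret eta: leibniz_hom Q1 Q2 \<eta> using iso by (simp add: leibniz_iso_def)
  interpret inv: leibniz_hom Q2 Q1 "inv \<eta>"
    using leibniz_iso_inv[OF iso] by (simp add: leibniz_iso_def)
  have bij: "bij \<eta>" using iso by (simp add: leibniz_iso_def)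
  obtain \<phi> where \<phi>: "leibniz_hom F1 F2 \<phi>" "\<rho>2 \<circ> \<phi> = \<eta> \<circ> \<rho>1"
    using lift_exists[OF p1.free p2.leibniz_hom_axioms p2.surj_rho
        leibniz_hom_comp[OF p1.leibniz_hom_axioms eta.leibniz_hom_axioms]] by blast
  obtain \<psi> where \<psi>: "leibniz_hom F2 F1 \<psi>" "\<rho>1 \<circ> \<psi> = inv \<eta> \<circ> \<rho>2"
    using lift_exists[OF p2.free p1.leibniz_hom_axioms p1.surj_rho
        leibniz_hom_comp[OF p2.leibniz_hom_axioms inv.leibniz_hom_axioms]] by blast
  interpret phi: leibniz_hom F1 F2 \<phi> by fact
  interpret comp: leibniz_hom F1 F1 "\<psi> \<circ> \<phi>" using \<phi>(1) \<psi>(1) by (rule leibniz_hom_comp)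
  obtain r where r: "r \<in> ker \<rho>1 \<inter> Lie_commutator F1 UNIV UNIV" "c = HL2_class F1 \<rho>1 r"
    using assms by (auto simp: HL2_def)
  have \<phi>r: "\<phi> r \<in> ker \<rho>2 \<inter> Lie_commutator F2 UNIV UNIV"
    using r(1) fun_cong[OF \<phi>(2), of r] phi.Lie_commutator_image[of UNIV UNIV UNIV UNIV]
    by (auto simp: ker_def eta.zero)
  have "(\<psi> \<circ> \<phi>) r - id r \<in> Lie_commutator F1 (ker \<rho>1) UNIV"
  proof (rule comp.hom_diff_Lie_commutator)
    show "leibniz_hom F1 F1 id" by (rule leibniz_hom_id) (rule p1.A.leibniz_algebra_axioms)
    show "(\<psi> \<circ> \<phi>) x - id x \<in> ker \<rho>1" for x
      using fun_cong[OF \<phi>(2), of x] fun_cong[OF \<psi>(2), of "\<phi> x"] bij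
      by (simp add: ker_def p1.diff bij_is_inj)
  qed (use r in auto)
  then show ?thesis
    using HL2_map_eq[OF p1 p2 eta.leibniz_hom_axioms \<phi> r(1)]
      HL2_map_eq[OF p2 p1 inv.leibniz_hom_axioms \<psi> \<phi>r] r(2)
    by (simp add: p1.class_eq_iff)
qed

end

lemma HL2_map_bij:
  assumes "free_presentation F1 Q1 \<rho>1" and "free_presentation F2 Q2 \<rho>2"
    and "leibniz_iso Q1 Q2 \<eta>"
  shows "bij_betw (HL2_map F1 \<rho>1 F2 \<rho>2 \<eta>) (HL2 F1 \<rho>1) (HL2 F2 \<rho>2)"
proof (rule bij_betw_byWitness)
  note inv = leibniz_iso_inv[OF assms(3)]
  have "inv (inv \<eta>) = \<eta>" using assms(3) by (simp add: leibniz_iso_def inv_inv_eq)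
  then show "\<forall>c\<in>HL2 F2 \<rho>2. HL2_map F1 \<rho>1 F2 \<rho>2 \<eta> (HL2_map F2 \<rho>2 F1 \<rho>1 (inv \<eta>) c) = c"
    using HL2_map_inv[OF assms(2,1) inv] by simp
  show "HL2_map F2 \<rho>2 F1 \<rho>1 (inv \<eta>) ` HL2 F2 \<rho>2 \<subseteq> HL2 F1 \<rho>1"
    using HL2_map_in_HL2[OF assms(2,1) inv] by blast
qed (use HL2_map_in_HL2[OF assms] HL2_map_inv[OF assms] in auto)

section \<open>Subsets under bijections, and isomorphisms from equal kernels\<close>

lemma image_Collect_eq_iff:
  assumes "bij_betw f A B"
  shows "f ` {x \<in> A. P x} = {y \<in> B. R y} \<longleftrightarrow> (\<forall>x\<in>A. P x \<longleftrightarrow> R (f x))"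
proof -
  have "{y \<in> B. R y} = f ` {x \<in> A. R (f x)}" using assms by (auto simp: bij_betw_def)
  moreover have "inj_on f A" using assms by (rule bij_betw_imp_inj_on)
  then have "f ` {x \<in> A. P x} = f ` {x \<in> A. R (f x)} \<longleftrightarrow> {x \<in> A. P x} = {x \<in> A. R (f x)}"
    by (rule inj_on_image_eq_iff) auto
  ultimately show ?thesis by auto
qed

text \<open>Both images are the quotient of \<open>D\<close> by one and the same kernel, so
  \<open>f d\<close> determines \<open>g d\<close> and conversely.\<close>

lemma leibniz_iso_on_quotient:
  assumes f: "leibniz_hom F A f" and g: "leibniz_hom F B g" and D: "two_sided_ideal F D"
    and ker: "\<And>d. d \<in> D \<Longrightarrow> f d = 0 \<longleftrightarrow> g d = 0"
  obtains h where "leibniz_iso_on A (f ` D) B (g ` D) h" and "\<And>d. d \<in> D \<Longrightarrow> h (f d) = g d"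
proof
  interpret f: leibniz_hom F A f by fact
  interpret g: leibniz_hom F B g by fact
  note I = two_sided_idealD[OF D f.A.leibniz_algebra_axioms]
  have eq: "f d = f e \<longleftrightarrow> g d = g e" if "d \<in> D" "e \<in> D" for d e
    using ker[OF I(4)[OF that]] by (simp add: f.diff g.diff)
  \<comment> \<open>The preimage in \<open>D\<close> is arbitrary; by \<open>eq\<close> its image
    under \<open>g\<close> does not depend on the choice.\<close>
  define h where "h = g \<circ> inv_into D f"
  show h: "h (f d) = g d" if "d \<in> D" for d
    unfolding h_def using that eq[of "inv_into D f (f d)" d]
    by (simp add: inv_into_into f_inv_into_f)
  have "bij_betw h (f ` D) (g ` D)"
    unfolding bij_betw_def inj_on_def using h eq by (auto simp: image_image)
  moreover have "h (f d + f e) = g d + g e" "h (brk A (f d) (f e)) = brk B (g d) (g e)"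
    "h (scale A c (f d)) = scale B c (g d)" if "d \<in> D" "e \<in> D" for c d e
    using h[OF I(2)[OF that]] h[OF I(5)[OF that(1)], of e] h[OF I(3)[OF that(1)], of c]
    by (simp_all add: f.add g.add f.hom_brk g.hom_brk f.scale g.scale)
  ultimately show "leibniz_iso_on A (f ` D) B (g ` D) h"
    by (auto simp: leibniz_iso_on_def h)
qed

theorem theorem4p3:
  fixes N1 :: "('k::field, 'n1::ab_group_add) alg" and G1 :: "('k, 'g1::ab_group_add) alg"
    and Q1 :: "('k, 'q1::ab_group_add) alg" and \<chi>1 :: "'n1 \<Rightarrow> 'g1" and \<pi>1 :: "'g1 \<Rightarrow> 'q1"
    and N2 :: "('k, 'n2::ab_group_add) alg" and G2 :: "('k, 'g2::ab_group_add) alg"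
    and Q2 :: "('k, 'q2::ab_group_add) alg" and \<chi>2 :: "'n2 \<Rightarrow> 'g2" and \<pi>2 :: "'g2 \<Rightarrow> 'q2"
    and F1 :: "('k, 'f1::ab_group_add) alg" and \<rho>1 :: "'f1 \<Rightarrow> 'q1"
    and F2 :: "('k, 'f2::ab_group_add) alg" and \<rho>2 :: "'f2 \<Rightarrow> 'q2"
    and \<eta> :: "'q1 \<Rightarrow> 'q2"
  assumes "(2::'k) \<noteq> 0"
    and "Lie_central_extension N1 G1 Q1 \<chi>1 \<pi>1"
    and "Lie_central_extension N2 G2 Q2 \<chi>2 \<pi>2"
    and "free_presentation F1 Q1 \<rho>1"
    and "free_presentation F2 Q2 \<rho>2"
    and "leibniz_iso Q1 Q2 \<eta>"
  shows "((\<exists>\<xi>. Lie_isoclinism G1 Q1 \<pi>1 G2 Q2 \<pi>2 \<eta> \<xi>)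
           \<longleftrightarrow>
         (\<exists>\<beta>. leibniz_iso_on G1 (Lie_commutator G1 UNIV UNIV) G2 (Lie_commutator G2 UNIV UNIV) \<beta> \<and>
           (\<forall>c \<in> HL2 F1 \<rho>1. \<beta> (theta' F1 \<rho>1 G1 \<chi>1 \<pi>1 c) =
              theta' F2 \<rho>2 G2 \<chi>2 \<pi>2 (HL2_map F1 \<rho>1 F2 \<rho>2 \<eta> c))))
       \<and>
        ((\<exists>\<beta>. leibniz_iso_on G1 (Lie_commutator G1 UNIV UNIV) G2 (Lie_commutator G2 UNIV UNIV) \<beta> \<and>
           (\<forall>c \<in> HL2 F1 \<rho>1. \<beta> (theta' F1 \<rho>1 G1 \<chi>1 \<pi>1 c) =
              theta' F2 \<rho>2 G2 \<chi>2 \<pi>2 (HL2_map F1 \<rho>1 F2 \<rho>2 \<eta> c)))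
           \<longleftrightarrow>
         HL2_map F1 \<rho>1 F2 \<rho>2 \<eta> ` ker_theta F1 \<rho>1 G1 \<chi>1 \<pi>1 = ker_theta F2 \<rho>2 G2 \<chi>2 \<pi>2)"
    (is "(?a \<longleftrightarrow> ?b) \<and> (?b \<longleftrightarrow> ?c)")
proof -
  interpret e1: Lie_central_extension N1 G1 Q1 \<chi>1 \<pi>1 by fact
  interpret e2: Lie_central_extension N2 G2 Q2 \<chi>2 \<pi>2 by fact
  interpret p1: free_presentation F1 Q1 \<rho>1 by fact
  interpret p2: free_presentation F2 Q2 \<rho>2 by fact
  interpret eta: leibniz_hom Q1 Q2 \<eta> using assms(6) by (simp add: leibniz_iso_def)
  have bij: "bij \<eta>" using assms(6) by (simp add: leibniz_iso_def)
  obtain \<mu> where \<mu>: "leibniz_hom F1 G1 \<mu>" "\<pi>1 \<circ> \<mu> = \<rho>1"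
    using lift_exists[OF p1.free e1.pi.leibniz_hom_axioms e1.surj_pi p1.leibniz_hom_axioms]
    by blast
  obtain \<nu> where \<nu>: "leibniz_hom F2 G2 \<nu>" "\<pi>2 \<circ> \<nu> = \<rho>2"
    using lift_exists[OF p2.free e2.pi.leibniz_hom_axioms e2.surj_pi p2.leibniz_hom_axioms]
    by blast
  obtain \<phi> where \<phi>: "leibniz_hom F1 F2 \<phi>" "\<rho>2 \<circ> \<phi> = \<eta> \<circ> \<rho>1"
    using lift_exists[OF p1.free p2.leibniz_hom_axioms p2.surj_rho
        leibniz_hom_comp[OF p1.leibniz_hom_axioms eta.leibniz_hom_axioms]] by blast
  \<comment> \<open>Factoring the lift through \<open>F2\<close> lets \<open>\<sigma>\<close>
    compute \<open>theta\<close> of the second extension after \<open>HL2_map\<close>; see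
    \<open>\<theta>2\<close>.\<close>
  define \<sigma> where "\<sigma> = \<nu> \<circ> \<phi>"
  have \<sigma>: "leibniz_hom F1 G2 \<sigma>" unfolding \<sigma>_def using \<phi>(1) \<nu>(1) by (rule leibniz_hom_comp)
  have \<sigma>2: "\<pi>2 \<circ> \<sigma> = \<eta> \<circ> \<rho>1" using \<phi>(2) \<nu>(2) by (simp add: \<sigma>_def o_assoc)
  interpret mu: leibniz_hom F1 G1 \<mu> by fact
  interpret phi: leibniz_hom F1 F2 \<phi> by fact
  interpret sigma: leibniz_hom F1 G2 \<sigma> by fact
  let ?D = "Lie_commutator F1 UNIV UNIV"
  note D = two_sided_idealD[OF p1.A.ideal_Lie_commutator[of UNIV UNIV]
      p1.A.leibniz_algebra_axioms]
  have \<mu>D: "\<mu> ` ?D = Lie_commutator G1 UNIV UNIV"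
    using p1.surj_rho by (intro e1.Lie_commutator_lift_image) (auto simp: \<mu>)
  have \<sigma>D: "\<sigma> ` ?D = Lie_commutator G2 UNIV UNIV"
    using comp_surj[OF p1.surj_rho bij_is_surj[OF bij]] \<sigma>
    by (intro e2.Lie_commutator_lift_image) (simp_all only: \<sigma>2)
  have \<theta>1: "\<chi>1 (theta F1 \<rho>1 G1 \<chi>1 \<pi>1 (HL2_class F1 \<rho>1 r)) = \<mu> r"
    if "r \<in> ker \<rho>1 \<inter> ?D" for r
    by (rule theta_eq[OF assms(2,4) \<mu> that])
  have \<theta>2: "\<chi>2 (theta F2 \<rho>2 G2 \<chi>2 \<pi>2 (HL2_map F1 \<rho>1 F2 \<rho>2 \<eta> (HL2_class F1 \<rho>1 r))) = \<sigma> r"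
    if r: "r \<in> ker \<rho>1 \<inter> ?D" for r
  proof -
    have "\<phi> r \<in> ker \<rho>2 \<inter> Lie_commutator F2 UNIV UNIV"
      using r fun_cong[OF \<phi>(2), of r] phi.Lie_commutator_image[of UNIV UNIV UNIV UNIV]
      by (auto simp: ker_def eta.zero)
    then show ?thesis
      using theta_eq[OF assms(3,5) \<nu>] HL2_map_eq[OF assms(4,5) eta.leibniz_hom_axioms \<phi> r]
      by (simp add: \<sigma>_def)
  qed
  have \<chi>1: "\<chi>1 n = 0 \<longleftrightarrow> n = 0" for n using e1.inj_chi e1.chi.zero by (metis injD)
  have \<chi>2: "\<chi>2 n = 0 \<longleftrightarrow> n = 0" for n using e2.inj_chi e2.chi.zero by (metis injD)
  \<comment> \<open>Bijectivity of \<open>HL2_map\<close> turns the equality of kernels into an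
    equivalence for each class, which is then read off on representatives.\<close>
  have c_iff: "?c \<longleftrightarrow> (\<forall>r \<in> ker \<rho>1 \<inter> ?D. \<mu> r = 0 \<longleftrightarrow> \<sigma> r = 0)"
    unfolding ker_theta_def image_Collect_eq_iff[OF HL2_map_bij[OF assms(4,5,6)]]
    unfolding HL2_def ball_simps
    using \<theta>1 \<theta>2 \<chi>1 \<chi>2 by (intro ball_cong) metis+
  have b_iff: "(\<forall>c \<in> HL2 F1 \<rho>1. \<beta> (theta' F1 \<rho>1 G1 \<chi>1 \<pi>1 c) =
        theta' F2 \<rho>2 G2 \<chi>2 \<pi>2 (HL2_map F1 \<rho>1 F2 \<rho>2 \<eta> c))
      \<longleftrightarrow> (\<forall>r \<in> ker \<rho>1 \<inter> ?D. \<beta> (\<mu> r) = \<sigma> r)" for \<beta>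
    unfolding HL2_def theta'_def ball_simps using \<theta>1 \<theta>2 by (intro ball_cong) auto
  have C1: "commutator_map G1 \<pi>1 (\<rho>1 a) (\<rho>1 b) = \<mu> (brk F1 a b + brk F1 b a)" for a b
    using e1.commutator_map_eq[of "\<mu> a" "\<mu> b"] fun_cong[OF \<mu>(2)] by (simp add: mu.add mu.hom_brk)
  have C2: "commutator_map G2 \<pi>2 (\<eta> (\<rho>1 a)) (\<eta> (\<rho>1 b)) = \<sigma> (brk F1 a b + brk F1 b a)" for a b
    using e2.commutator_map_eq[of "\<sigma> a" "\<sigma> b"] fun_cong[OF \<sigma>2]
    by (simp add: sigma.add sigma.hom_brk)

  have "?a \<Longrightarrow> ?b"
  proof -
    assume ?a
    then obtain \<xi> where iso: "leibniz_iso_on G1 (\<mu> ` ?D) G2 (\<sigma> ` ?D) \<xi>"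
      and comm: "\<xi> (commutator_map G1 \<pi>1 p q) = commutator_map G2 \<pi>2 (\<eta> p) (\<eta> q)" for p q
      unfolding Lie_isoclinism_def \<mu>D \<sigma>D by blast
    have gen: "\<xi> (\<mu> (brk F1 a b + brk F1 b a)) = \<sigma> (brk F1 a b + brk F1 b a)" for a b
      using comm[of "\<rho>1 a" "\<rho>1 b"] by (simp only: C1 C2)
    have add: "\<xi> (\<mu> (d + e)) = \<xi> (\<mu> d) + \<xi> (\<mu> e)" if "d \<in> ?D" "e \<in> ?D" for d e
      using iso that by (simp add: leibniz_iso_on_def mu.add)
    have scl: "\<xi> (\<mu> (scale F1 c d)) = scale G2 c (\<xi> (\<mu> d))" if "d \<in> ?D" for c d
      using iso that by (simp add: leibniz_iso_on_def mu.scale)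
    have zero: "\<xi> 0 = 0" using add[OF D(1) D(1)] by (simp add: mu.zero)
    \<comment> \<open>By \<open>gen\<close>, \<open>\<xi>\<close> is known only on symmetrised
      brackets; showing that \<open>?E\<close> is an ideal extends this to all of
      \<open>?D\<close>.\<close>
    let ?E = "{d \<in> ?D. \<xi> (\<mu> d) = \<sigma> d}"
    have "two_sided_ideal F1 ?E"
      unfolding two_sided_ideal_def p1.A.subspace_def
    proof (intro conjI ballI allI)
      fix d x assume d: "d \<in> ?E"
      \<comment> \<open>As \<open>x\<close> may lie outside \<open>?D\<close>, multiplicativity of
        \<open>\<xi>\<close> does not apply. But \<open>[x, d] = 0\<close> makes
        \<open>[d, x]\<close> a symmetrised bracket, to which \<open>gen\<close> applies.\<close>
      have xd: "brk F1 x d = 0" using d p1.A.brk_Lie_commutator_right by blast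
      then show "brk F1 x d \<in> ?E" using D(1) by (simp add: zero mu.zero sigma.zero)
      show "brk F1 d x \<in> ?E" using d gen[of d x] xd D(5) by simp
    qed (auto simp: D zero add scl mu.zero sigma.zero sigma.add sigma.scale)
    then have "?D \<subseteq> ?E"
      by (rule p1.A.Lie_commutator_subset) (simp add: gen p1.A.Lie_commutator_gen)
    then show ?b unfolding b_iff using iso unfolding \<mu>D \<sigma>D by blast
  qed
  moreover have "?b \<Longrightarrow> ?c"
  proof -
    assume ?b
    then obtain \<beta> where iso: "leibniz_iso_on G1 (\<mu> ` ?D) G2 (\<sigma> ` ?D) \<beta>"
      and \<beta>: "\<And>r. r \<in> ker \<rho>1 \<inter> ?D \<Longrightarrow> \<beta> (\<mu> r) = \<sigma> r"
      unfolding b_iff \<mu>D \<sigma>D by blast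
    \<comment> \<open>Comparing \<open>r\<close> with \<open>0\<close> lets injectivity of
      \<open>\<beta>\<close> identify the two kernels.\<close>
    have 0: "0 \<in> ker \<rho>1 \<inter> ?D" by (simp add: D(1) ker_def p1.zero)
    have "inj_on \<beta> (\<mu> ` ?D)" using iso by (simp add: leibniz_iso_on_def bij_betw_def)
    then have "\<mu> r = \<mu> 0 \<longleftrightarrow> \<sigma> r = \<sigma> 0" if "r \<in> ker \<rho>1 \<inter> ?D" for r
      using inj_on_eq_iff[of \<beta> "\<mu> ` ?D" "\<mu> r" "\<mu> 0"] that 0
      by (simp only: \<beta>[OF that] \<beta>[OF 0] Int_iff imageI)
    then show ?c unfolding c_iff by (simp add: mu.zero sigma.zero)
  qed
  moreover have "?c \<Longrightarrow> ?a"
  proof -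
    assume ?c
    then have *: "\<mu> r = 0 \<longleftrightarrow> \<sigma> r = 0" if "r \<in> ker \<rho>1 \<inter> ?D" for r
      using that unfolding c_iff by blast
    have "\<mu> d = 0 \<longleftrightarrow> \<sigma> d = 0" if "d \<in> ?D" for d
    proof -
      have "\<mu> d = 0 \<Longrightarrow> \<rho>1 d = 0" using fun_cong[OF \<mu>(2), of d] e1.pi.zero by simp
      moreover have "\<sigma> d = 0 \<Longrightarrow> \<rho>1 d = 0"
        using fun_cong[OF \<sigma>2, of d] e2.pi.zero eta.zero bij_is_inj[OF bij]
        by (metis comp_apply injD)
      ultimately show ?thesis using *[of d] that by (auto simp: ker_def)
    qed
    then obtain \<xi> where iso: "leibniz_iso_on G1 (\<mu> ` ?D) G2 (\<sigma> ` ?D) \<xi>"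
      and \<xi>: "\<And>d. d \<in> ?D \<Longrightarrow> \<xi> (\<mu> d) = \<sigma> d"
      using leibniz_iso_on_quotient[OF \<mu>(1) \<sigma> p1.A.ideal_Lie_commutator] by blast
    have "\<xi> (commutator_map G1 \<pi>1 p q) = commutator_map G2 \<pi>2 (\<eta> p) (\<eta> q)" for p q
    proof -
      obtain a b where "p = \<rho>1 a" "q = \<rho>1 b" using p1.surj_rho by (metis surjD)
      then show ?thesis using \<xi> p1.A.Lie_commutator_gen by (simp add: C1 C2)
    qed
    then show ?a using iso assms(6) unfolding Lie_isoclinism_def \<mu>D \<sigma>D by blast
  qed
  ultimately show ?thesis by blast
qed

end
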